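(* The holomorphic map $$f\colon\Delta^2\longrightarrow\Omega_{\mathrm V},\qquad f(z_1,z_2)=\Bigl(0,0,0,0,\ \tfrac{z_1-z_2}{\sqrt2}+i\,\tfrac{z_1+z_2}{\sqrt2}\,e_1,\ 0\Bigr),$$ is an embedding and satisfies $g_{\Delta^2}=f^*g_{\Omega_{\mathrm V}}$. In particular, its image $$\Pi'=\operatorname{Im}(f)=\{(0,0,0,0,Z_2,0)\in\Omega_{\mathrm V} : Z_2\in\operatorname{Span}_{\mathbb{C}}\{1,e_1\}\}$$ is a totally geodesic polydisk of maximal rank in $\Omega_{\mathrm V}$ (that is, of complex dimension equal to the rank of $\Omega_{\mathrm V}$, which is $2$).
   Context: Let $\mathbb{O}_{\mathbb{C}}=\mathbb{O}\otimes_{\mathbb{R}}\mathbb{C}$ be the complexified octonions with standard Cayley basis $1,e_1,\dots,e_7$. Write $Z=z_0+\mathbf z=z_0+\sum_{j=1}^7z_je_j$ and $W=w_0+\mathbf w=w_0+\sum_{j=1}^7w_je_j$ with $z_j,w_j\in\mathbb{C}$. Put $\widetilde Z=z_0-\mathbf z$ (Cayley conjugation), $\overline Z=\overline{z_0}+\overline{\mathbf z}$ (complex conjugation), $\langle\mathbf z,\mathbf w\rangle=\sum_{j=1}^7z_jw_j$, $\langle Z,W\rangle=z_0w_0+\langle\mathbf z,\mathbf w\rangle$, and let the complex-bilinear octonionic product be $ZW=(z_0w_0-\langle\mathbf z,\mathbf w\rangle,\ z_0\mathbf w+w_0\mathbf z+\mathbf z\times\mathbf w)$, where $\mathbf z\times\mathbf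 w$ is the complex-bilinear extension of the Cayley cross product to $\mathbb{C}^7$. Let $\mathcal H=\{z=(z_1,z_2,z_3,Z_1,Z_2,Z_3) : z_j\in\mathbb{C},\ Z_j\in\mathbb{O}_{\mathbb{C}}\}\cong\mathbb{C}^{27}$, with complex conjugation $z\mapsto\bar z$ taken componentwise and Hermitian form $(x\mid y)=\sum_{j=1}^3z_j\overline{w_j}+\sum_{j=1}^3\langle Z_j,\overline{W_j}\rangle$ for $x=(z_j,Z_j)$, $y=(w_j,W_j)$. The Freudenthal adjoint is $$z^\sharp=\Bigl(z_2z_3-\tfrac12\langle Z_1,Z_1\rangle,\ z_3z_1-\tfrac12\langle Z_2,Z_2\rangle,\ z_1z_2-\tfrac12\langle Z_3,Z_3\rangle,\ Z_2Z_3-z_1\widetilde Z_1,\ Z_3Z_1-z_2\widetilde Z_2,\ Z_1Z_2-z_3\widetilde Z_3\Bigr).$$ The exceptional domain of type VI is the set $\Omega_{\mathrm{VI}}$ of $z\in\mathcal H$ with $1-(z\mid z)+(z^\sharp\mid z^\sharp)-|\frac13(z^\sharp\mid\bar z)|^2>0$, $3-2(z\mid z)+(z^\sharp\mid z^\sharp)>0$ and $3-(z\mid z)>0$. Let $\mathcal H'=\{(0,0,0,0,Z_2,Z_3) : Z_2,Z_3\in\mathbb{O}_{\mathbb{C}}\}\subset\mathcal H$. The exceptional domain of type V is the bounded symmetric domain (complex dimension 16, rank 2) $$\Omega_{\mathrm V}=\Omega_{\mathrm{VI}}\cap\mathcal H'=\{z\in\mathcal H' : 1-(z\mid z)+(z^\sharp\mid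 z^\sharp)>0,\ 2-(z\mid z)>0\}.$$ Its generic norm is $N_{\Omega_{\mathrm V}}(z,\bar w)=1-(z\mid w)+(z^\sharp\mid w^\sharp)$ for $z,w\in\mathcal H'$, and its hyperbolic metric $g_{\Omega_{\mathrm V}}$ is the Kähler metric with Kähler form $-\frac i2\partial\bar\partial\log N_{\Omega_{\mathrm V}}(z,\bar z)$. $\Delta^2=\{z\in\mathbb{C}^2 : |z_1|<1,|z_2|<1\}$ carries the Kähler metric $g_{\Delta^2}$ with Kähler form $-\frac i2\partial\bar\partial\log\prod_{j=1}^2(1-|z_j|^2)$. A totally geodesic polydisk in $\Omega_{\mathrm V}$ is the image of a totally geodesic holomorphic isometric embedding of some $(\Delta^k,g_{\Delta^k})$ (same definition with $k$ factors). An isometric embedding is totally geodesic if its second fundamental form vanishes. *)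

theory Defs
  imports "HOL-Analysis.Analysis" "HOL-Computational_Algebra.Polynomial"
begin

section \<open>Complexified octonions\<close>

text \<open>The component with index \<open>0\<close> is the coefficient of the unit \<open>1\<close>, the component with
  index \<open>j\<close> is the coefficient of \<open>e\<^sub>j\<close>.\<close>

type_synonym octc = "complex ^ 8"

definition cbil :: "complex ^ 'n \<Rightarrow> complex ^ 'n \<Rightarrow> complex" where
  "cbil z w = (\<Sum>k\<in>UNIV. z $ k * w $ k)"

definition vcnj :: "complex ^ 'n \<Rightarrow> complex ^ 'n" where
  "vcnj z = (\<chi> k. cnj (z $ k))"

definition cayley_cnj :: "octc \<Rightarrow> octc" where
  "cayley_cnj Z = (\<chi> k. if k = 0 then Z $ 0 else - (Z $ k))"

text \<open>Cayley's multiplication table: \<open>e\<^sub>a e\<^sub>b = e\<^sub>c\<close> for \<open>(a,b,c)\<close> a cyclic permutation of one of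
  \<open>(1,2,3), (1,4,5), (1,7,6), (2,4,6), (2,5,7), (3,4,7), (3,6,5)\<close>. The components with index
  \<open>0\<close> of the arguments are ignored.\<close>

definition cayley_cross :: "octc \<Rightarrow> octc \<Rightarrow> octc" where
  "cayley_cross z w = (let m = (\<lambda>a b. z $ a * w $ b - z $ b * w $ a) in
     \<chi> k. if k = 1 then m 2 3 + m 4 5 + m 7 6
          else if k = 2 then m 3 1 + m 4 6 + m 5 7
          else if k = 3 then m 1 2 + m 4 7 + m 6 5
          else if k = 4 then m 5 1 + m 6 2 + m 7 3
          else if k = 5 then m 1 4 + m 7 2 + m 3 6
          else if k = 6 then m 1 7 + m 2 4 + m 5 3
          else if k = 7 then m 6 1 + m 2 5 + m 3 4
          else 0)"

definition oct_mult :: "octc \<Rightarrow> octc \<Rightarrow> octc" (infixl "\<odot>" 70) where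
  "Z \<odot> W = (\<chi> k. if k = 0 then Z $ 0 * W $ 0 - (\<Sum>j\<in>UNIV - {0}. Z $ j * W $ j)
                else Z $ 0 * W $ k + W $ 0 * Z $ k + cayley_cross Z W $ k)"


section \<open>The space \<open>\<H>\<close> and the exceptional domains\<close>

text \<open>Index \<open>Inl j\<close> is the scalar entry \<open>z\<^sub>j\<close>, index \<open>Inr (j, k)\<close> is the component \<open>k\<close> of the
  octonionic entry \<open>Z\<^sub>j\<close>. In the type \<open>3\<close> the numeral \<open>3\<close> denotes the element \<open>0\<close>.\<close>

type_synonym herm3 = "complex ^ (3 + 3 \<times> 8)"

definition sc :: "herm3 \<Rightarrow> 3 \<Rightarrow> complex" where
  "sc z j = z $ Inl j"

definition oc :: "herm3 \<Rightarrow> 3 \<Rightarrow> octc" where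
  "oc z j = (\<chi> k. z $ Inr (j, k))"

definition mkH :: "complex \<Rightarrow> complex \<Rightarrow> complex \<Rightarrow> octc \<Rightarrow> octc \<Rightarrow> octc \<Rightarrow> herm3" where
  "mkH a b c A B C = (\<chi> i. case i of
      Inl j \<Rightarrow> (if j = 1 then a else if j = 2 then b else c)
    | Inr (j, k) \<Rightarrow> (if j = 1 then A $ k else if j = 2 then B $ k else C $ k))"

definition hform :: "herm3 \<Rightarrow> herm3 \<Rightarrow> complex" where
  "hform x y = (\<Sum>j\<in>UNIV. sc x j * cnj (sc y j)) + (\<Sum>j\<in>UNIV. cbil (oc x j) (vcnj (oc y j)))"

text \<open>With the quadratic terms \<open>\<langle>Z\<^sub>j,Z\<^sub>j\<rangle>/2\<close> and the products \<open>Z\<^sub>2 Z\<^sub>3\<close> etc. taken without a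
  factor \<open>1/\<surd>2\<close>, the form \<open>g_V\<close> below is not definite at every point of \<open>Omega_V\<close>:
  at \<open>Z\<^sub>2 = t(1 + \<i>e\<^sub>1)/\<surd>2\<close>, \<open>Z\<^sub>3 = 0\<close> with \<open>2t\<^sup>2 > 1\<close> it is negative on the vector with
  \<open>Z\<^sub>2 = 0\<close>, \<open>Z\<^sub>3 = 1 + \<i>e\<^sub>1\<close>. No definition in this theory presupposes definiteness.\<close>

definition sharp :: "herm3 \<Rightarrow> herm3" where
  "sharp z = mkH
     (sc z 2 * sc z 3 - cbil (oc z 1) (oc z 1) / 2)
     (sc z 3 * sc z 1 - cbil (oc z 2) (oc z 2) / 2)
     (sc z 1 * sc z 2 - cbil (oc z 3) (oc z 3) / 2)
     (oc z 2 \<odot> oc z 3 - sc z 1 *s cayley_cnj (oc z 1))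
     (oc z 3 \<odot> oc z 1 - sc z 2 *s cayley_cnj (oc z 2))
     (oc z 1 \<odot> oc z 2 - sc z 3 *s cayley_cnj (oc z 3))"

text \<open>\<open>Re\<close> only changes the type here: \<open>(x | x)\<close> is real.\<close>

definition Omega_VI :: "herm3 set" where
  "Omega_VI = {z.
      1 - Re (hform z z) + Re (hform (sharp z) (sharp z))
        - (cmod (hform (sharp z) (vcnj z) / 3))\<^sup>2 > 0 \<and>
      3 - 2 * Re (hform z z) + Re (hform (sharp z) (sharp z)) > 0 \<and>
      3 - Re (hform z z) > 0}"

definition Hprime :: "herm3 set" where
  "Hprime = {mkH 0 0 0 0 Z2 Z3 | Z2 Z3. True}"

definition Omega_V :: "herm3 set" where
  "Omega_V = Omega_VI \<inter> Hprime"

text \<open>\<open>N_V z w\<close> is the value \<open>N(z, w\<^sup>-)\<close>, so it is antiholomorphic in the second argument.\<close>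

definition N_V :: "herm3 \<Rightarrow> herm3 \<Rightarrow> complex" where
  "N_V z w = 1 - hform z w + hform (sharp z) (sharp w)"

text \<open>The rank of a bounded symmetric domain is the degree of the generic minimal polynomial
  \<open>T\<^sup>r N(T\<^sup>-\<^sup>1 z, w\<^sup>-)\<close> of its Jordan triple system \<open>V\<close>, that is, the degree of the generic norm
  \<open>N\<close> in its first argument.\<close>

definition generic_norm_rank :: "(complex ^ 'n) set \<Rightarrow>
    (complex ^ 'n \<Rightarrow> complex ^ 'n \<Rightarrow> complex) \<Rightarrow> nat" where
  "generic_norm_rank V N =
     Max {degree p | p z w. z \<in> V \<and> w \<in> V \<and> (\<forall>t. poly p t = N (t *s z) w)}"


section \<open>Kaehler metrics on domains in complex linear subspaces\<close>

text \<open>Domains may be open subsets of a complex linear subspace \<open>V\<close> of the ambient space (as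
  \<open>Omega_V\<close> in \<open>Hprime\<close>); tangent vectors are the elements of \<open>V\<close>. Derivatives are taken along
  real lines so that for points and directions in \<open>V\<close> only the values on \<open>V\<close> matter.\<close>

definition dir_deriv :: "(complex ^ 'n \<Rightarrow> 'b::real_normed_vector) \<Rightarrow>
    complex ^ 'n \<Rightarrow> complex ^ 'n \<Rightarrow> 'b" where
  "dir_deriv f p v = vector_derivative (\<lambda>t. f (p + t *\<^sub>R v)) (at 0)"

definition del :: "(complex ^ 'n \<Rightarrow> complex) \<Rightarrow> complex ^ 'n \<Rightarrow> complex ^ 'n \<Rightarrow> complex" where
  "del f p v = (dir_deriv f p v - \<i> * dir_deriv f p (\<i> *s v)) / 2"

definition delbar :: "(complex ^ 'n \<Rightarrow> complex) \<Rightarrow> complex ^ 'n \<Rightarrow> complex ^ 'n \<Rightarrow> complex" where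
  "delbar f p v = (dir_deriv f p v + \<i> * dir_deriv f p (\<i> *s v)) / 2"

text \<open>In coordinates this is \<open>\<Sum>\<^sub>j\<^sub>k (\<partial>\<^sup>2f / \<partial>z\<^sub>j\<partial>z\<^sub>k\<^sup>-) dz\<^sub>j \<and> dz\<^sub>k\<^sup>-\<close>, with
  \<open>(\<alpha> \<and> \<beta>)(u, v) = \<alpha>(u) \<beta>(v) - \<alpha>(v) \<beta>(u)\<close>.\<close>

definition del_delbar :: "(complex ^ 'n \<Rightarrow> complex) \<Rightarrow>
    complex ^ 'n \<Rightarrow> complex ^ 'n \<Rightarrow> complex ^ 'n \<Rightarrow> complex" where
  "del_delbar f p u v = del (\<lambda>q. delbar f q v) p u - del (\<lambda>q. delbar f q u) p v"

definition kaehler_form :: "(complex ^ 'n \<Rightarrow> real) \<Rightarrow>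
    complex ^ 'n \<Rightarrow> complex ^ 'n \<Rightarrow> complex ^ 'n \<Rightarrow> complex" where
  "kaehler_form \<phi> p u v = - (\<i> / 2) * del_delbar (\<lambda>q. complex_of_real (ln (\<phi> q))) p u v"

text \<open>The metric of a Kaehler form \<open>\<omega>\<close> is \<open>g(u, v) = \<omega>(u, J v)\<close>; \<open>\<omega>\<close> is real-valued.\<close>

definition kaehler_metric :: "(complex ^ 'n \<Rightarrow> real) \<Rightarrow>
    complex ^ 'n \<Rightarrow> complex ^ 'n \<Rightarrow> complex ^ 'n \<Rightarrow> real" where
  "kaehler_metric \<phi> p u v = Re (kaehler_form \<phi> p u (\<i> *s v))"

definition g_V :: "herm3 \<Rightarrow> herm3 \<Rightarrow> herm3 \<Rightarrow> real" where
  "g_V = kaehler_metric (\<lambda>z. Re (N_V z z))"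

definition polydisk :: "(complex ^ 'k) set" where
  "polydisk = {z. \<forall>j. cmod (z $ j) < 1}"

definition g_polydisk :: "complex ^ 'k \<Rightarrow> complex ^ 'k \<Rightarrow> complex ^ 'k \<Rightarrow> real" where
  "g_polydisk = kaehler_metric (\<lambda>z. \<Prod>j\<in>UNIV. 1 - (cmod (z $ j))\<^sup>2)"


section \<open>Totally geodesic holomorphic isometric embeddings\<close>

definition holomorphic_map_on :: "(complex ^ 'k) set \<Rightarrow> (complex ^ 'k \<Rightarrow> complex ^ 'n) \<Rightarrow> bool" where
  "holomorphic_map_on D F \<longleftrightarrow> (\<forall>p\<in>D. \<exists>L. (F has_derivative L) (at p) \<and>
     (\<forall>c v. L (c *s v) = c *s L v))"

definition holomorphic_embedding :: "(complex ^ 'k) set \<Rightarrow> (complex ^ 'n) set \<Rightarrow>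
    (complex ^ 'k \<Rightarrow> complex ^ 'n) \<Rightarrow> bool" where
  "holomorphic_embedding D \<Omega> F \<longleftrightarrow>
     F ` D \<subseteq> \<Omega> \<and> holomorphic_map_on D F \<and>
     (\<forall>p\<in>D. inj (dir_deriv F p)) \<and> (\<exists>G. homeomorphism D (F ` D) F G)"

definition isometric_on :: "(complex ^ 'k) set \<Rightarrow>
    (complex ^ 'k \<Rightarrow> complex ^ 'k \<Rightarrow> complex ^ 'k \<Rightarrow> real) \<Rightarrow>
    (complex ^ 'n \<Rightarrow> complex ^ 'n \<Rightarrow> complex ^ 'n \<Rightarrow> real) \<Rightarrow>
    (complex ^ 'k \<Rightarrow> complex ^ 'n) \<Rightarrow> bool" where
  "isometric_on D h g F \<longleftrightarrow>
     (\<forall>p\<in>D. \<forall>u v. h p u v = g (F p) (dir_deriv F p u) (dir_deriv F p v))"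

text \<open>For constant vector fields \<open>a, b, c\<close> this is \<open>g(\<nabla>\<^sub>a b, c)\<close> by the Koszul formula, where \<open>\<nabla>\<close>
  is the Levi-Civita connection (Christoffel symbols of the first kind).\<close>

definition christoffel :: "(complex ^ 'n \<Rightarrow> complex ^ 'n \<Rightarrow> complex ^ 'n \<Rightarrow> real) \<Rightarrow>
    complex ^ 'n \<Rightarrow> complex ^ 'n \<Rightarrow> complex ^ 'n \<Rightarrow> complex ^ 'n \<Rightarrow> real" where
  "christoffel g p a b c =
     (dir_deriv (\<lambda>q. g q b c) p a + dir_deriv (\<lambda>q. g q a c) p b - dir_deriv (\<lambda>q. g q a b) p c) / 2"

definition normal_vectors :: "(complex ^ 'n) set \<Rightarrow>
    (complex ^ 'n \<Rightarrow> complex ^ 'n \<Rightarrow> complex ^ 'n \<Rightarrow> real) \<Rightarrow>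
    (complex ^ 'k \<Rightarrow> complex ^ 'n) \<Rightarrow> complex ^ 'k \<Rightarrow> (complex ^ 'n) set" where
  "normal_vectors V g F p = {\<xi> \<in> V. \<forall>w. g (F p) (dir_deriv F p w) \<xi> = 0}"

text \<open>The second fundamental form along a normal vector \<open>\<xi>\<close>, i.e.\ \<open>g(\<nabla>\<^sub>u (dF v), \<xi>)\<close> for the
  pull-back to the source of the Levi-Civita connection of \<open>g\<close> and a constant vector field
  \<open>v\<close>; where \<open>g\<close> is nondegenerate
  it is the pairing of the vector-valued form with \<open>\<xi>\<close>.\<close>

definition second_fundamental_form ::
    "(complex ^ 'n \<Rightarrow> complex ^ 'n \<Rightarrow> complex ^ 'n \<Rightarrow> real) \<Rightarrow>
    (complex ^ 'k \<Rightarrow> complex ^ 'n) \<Rightarrow>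
    complex ^ 'k \<Rightarrow> complex ^ 'k \<Rightarrow> complex ^ 'k \<Rightarrow> complex ^ 'n \<Rightarrow> real" where
  "second_fundamental_form g F p u v \<xi> =
     g (F p) (dir_deriv (\<lambda>q. dir_deriv F q v) p u) \<xi>
     + christoffel g (F p) (dir_deriv F p u) (dir_deriv F p v) \<xi>"

definition totally_geodesic_on :: "(complex ^ 'k) set \<Rightarrow> (complex ^ 'n) set \<Rightarrow>
    (complex ^ 'n \<Rightarrow> complex ^ 'n \<Rightarrow> complex ^ 'n \<Rightarrow> real) \<Rightarrow>
    (complex ^ 'k \<Rightarrow> complex ^ 'n) \<Rightarrow> bool" where
  "totally_geodesic_on D V g F \<longleftrightarrow>
     (\<forall>p\<in>D. \<forall>u v. \<forall>\<xi>\<in>normal_vectors V g F p. second_fundamental_form g F p u v \<xi> = 0)"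

text \<open>\<open>S\<close> is a totally geodesic polydisk of complex dimension \<open>CARD('k)\<close> in the domain \<open>\<Omega>\<close>
  of \<open>V\<close>; the first argument only carries the dimension.\<close>

definition totally_geodesic_polydisk :: "'k::finite itself \<Rightarrow> (complex ^ 'n) set \<Rightarrow>
    (complex ^ 'n) set \<Rightarrow> (complex ^ 'n \<Rightarrow> complex ^ 'n \<Rightarrow> complex ^ 'n \<Rightarrow> real) \<Rightarrow>
    (complex ^ 'n) set \<Rightarrow> bool" where
  "totally_geodesic_polydisk (k :: 'k itself) V \<Omega> g S \<longleftrightarrow>
     (\<exists>F :: complex ^ 'k \<Rightarrow> complex ^ 'n.
        holomorphic_embedding polydisk \<Omega> F \<and>
        isometric_on polydisk g_polydisk g F \<and>
        totally_geodesic_on polydisk V g F \<and>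
        S = F ` polydisk)"


section \<open>The map \<open>f\<close>\<close>

definition f_V :: "complex ^ 2 \<Rightarrow> herm3" where
  "f_V z = mkH 0 0 0 0
     (((z $ 1 - z $ 2) / complex_of_real (sqrt 2)) *s axis 0 1
      + (\<i> * ((z $ 1 + z $ 2) / complex_of_real (sqrt 2))) *s axis 1 1) 0"

definition Pi_prime :: "herm3 set" where
  "Pi_prime = {mkH 0 0 0 0 Z2 0 | Z2.
     mkH 0 0 0 0 Z2 0 \<in> Omega_V \<and> Z2 \<in> vec.span {axis 0 1, axis 1 1}}"

end

theory Submission
  imports Defs
begin

text \<open>
  On the image of \<open>f_V\<close> the only data entering the generic norm are
  \<open>(z | z) = |z\<^sub>1|\<^sup>2 + |z\<^sub>2|\<^sup>2\<close> and \<open>\<langle>Z\<^sub>2, Z\<^sub>2\<rangle> = - 2 z\<^sub>1 z\<^sub>2\<close>, so that \<open>N_V\<close> pulls back to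
  \<open>(1 - |z\<^sub>1|\<^sup>2)(1 - |z\<^sub>2|\<^sup>2)\<close> (lemma \<open>N_V_f_V\<close>). The operator \<open>\<partial>\<partial>\<^sup>-\<close> commutes with
  complex linear substitutions (\<open>kaehler_metric_compose_linear\<close>) and \<open>f_V\<close> is complex linear;
  hence \<open>f_V\<close> is isometric. The same two numbers decide membership in \<open>Omega_V\<close>: with
  \<open>x = |z\<^sub>1|\<^sup>2\<close> and \<open>y = |z\<^sub>2|\<^sup>2\<close> the inequalities of the domain cut out exactly \<open>x, y < 1\<close>
  (\<open>f_V_in_Omega_V_iff\<close>), which identifies the image.

  Since \<open>f_V\<close> is linear, its second fundamental form along \<open>\<xi>\<close> is the Christoffel symbol
  \<open>\<Gamma>(f u, f v, \<xi>)\<close>. Where the potential is positive, the metric and its Christoffel symbols are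
  additive in \<open>\<xi>\<close>, by three-fold differentiability of \<open>N_V\<close>. Write \<open>\<xi> \<in> Hprime\<close> as a vector
  of the image plus a vector whose \<open>Z\<^sub>2\<close> is spanned by \<open>e\<^sub>2, \<dots>, e\<^sub>7\<close> plus a vector with
  \<open>Z\<^sub>2 = 0\<close>. The map \<open>Z\<^sub>3 \<mapsto> - Z\<^sub>3\<close>, and on \<open>Z\<^sub>3 = 0\<close> the reflection of \<open>Z\<^sub>2\<close> in the plane of
  \<open>1\<close> and \<open>e\<^sub>1\<close>, preserve \<open>N_V\<close>, fix the image pointwise and reverse the third and the second
  summand, respectively. A quantity which is additive in \<open>\<xi>\<close> and invariant under \<open>\<xi> \<mapsto> - \<xi>\<close>
  vanishes, so both summands contribute nothing to the metric and to \<open>\<Gamma>\<close>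
  (\<open>mirrored_direction_is_normal\<close>, \<open>normal_to_f_V\<close>). If \<open>\<xi>\<close> is normal, its tangential summand is
  then orthogonal to the whole image, and it is zero because the metric of the polydisk is
  positive definite (\<open>g_polydisk_eq\<close>).

  The rank is read off from \<open>N_V (t z) w = 1 - t (z | w) + t\<^sup>2 (z\<^sup>\<sharp> | w\<^sup>\<sharp>)\<close>.
\<close>

section \<open>Directional derivatives and repeated differentiability\<close>

lemma has_vector_derivative_along_line:
  assumes "(f has_derivative f') (at p)"
  shows "((\<lambda>t. f (p + t *\<^sub>R v)) has_vector_derivative f' v) (at 0)"
proof -
  have "((\<lambda>t::real. p + t *\<^sub>R v) has_derivative (\<lambda>t. t *\<^sub>R v)) (at 0)"
    by (auto intro!: derivative_eq_intros)
  moreover have "(f has_derivative f') (at (p + 0 *\<^sub>R v))"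
    using assms by simp
  ultimately have "((\<lambda>t. f (p + t *\<^sub>R v)) has_derivative (\<lambda>t. f' (t *\<^sub>R v))) (at 0)"
    by (rule has_derivative_compose)
  then show ?thesis
    unfolding has_vector_derivative_def
    using linear_scale[OF has_derivative_linear[OF assms]] by simp
qed

lemma dir_deriv_eq:
  assumes "(f has_derivative f') (at p)"
  shows "dir_deriv f p v = f' v"
  unfolding dir_deriv_def
  by (rule vector_derivative_at[OF has_vector_derivative_along_line[OF assms]])

lemma dir_deriv_cong:
  assumes "open S" "p \<in> S" "\<And>q. q \<in> S \<Longrightarrow> f q = g q"
  shows "dir_deriv f p v = dir_deriv g p v"
proof -
  have "open ((\<lambda>t::real. p + t *\<^sub>R v) -` S)"
    by (intro open_vimage assms(1) continuous_intros)
  then have "\<forall>\<^sub>F t::real in nhds 0. t \<in> (\<lambda>t. p + t *\<^sub>R v) -` S"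
    by (rule eventually_nhds_in_open) (simp add: assms(2))
  then have "\<forall>\<^sub>F t::real in nhds 0. p + t *\<^sub>R v \<in> S"
    by simp
  then have "\<forall>\<^sub>F t::real in nhds 0. f (p + t *\<^sub>R v) = g (p + t *\<^sub>R v)"
    by (rule eventually_mono) (use assms(3) in auto)
  then show ?thesis
    unfolding dir_deriv_def by (intro vector_derivative_cong_eq) auto
qed

lemma del_cong:
  assumes "open S" "p \<in> S" "\<And>q. q \<in> S \<Longrightarrow> f q = g q"
  shows "del f p v = del g p v" "delbar f p v = delbar g p v"
proof -
  have "dir_deriv f p w = dir_deriv g p w" for w
    by (rule dir_deriv_cong[OF assms])
  then show "del f p v = del g p v" "delbar f p v = delbar g p v"
    by (simp_all add: del_def delbar_def)
qed

lemma dir_deriv_zero [simp]: "dir_deriv f p 0 = 0"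
  by (simp add: dir_deriv_def)

text \<open>Existence of iterated derivatives along fixed directions. Each level asks for a full
  derivative and not only for directional ones, which makes every directional derivative of
  order at most \<open>k\<close> additive in the direction taken last.\<close>

primrec differentiable_upto ::
    "nat \<Rightarrow> 'a set \<Rightarrow> ('a::real_normed_vector \<Rightarrow> 'b::real_normed_vector) \<Rightarrow> bool" where
  "differentiable_upto 0 S f = True"
| "differentiable_upto (Suc k) S f \<longleftrightarrow>
     (\<exists>f'. (\<forall>x\<in>S. (f has_derivative f' x) (at x)) \<and> (\<forall>v. differentiable_upto k S (\<lambda>x. f' x v)))"

lemma differentiable_upto_SucI:
  assumes "\<And>x. x \<in> S \<Longrightarrow> (f has_derivative f' x) (at x)"
    and "\<And>v. differentiable_upto k S (\<lambda>x. f' x v)"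
  shows "differentiable_upto (Suc k) S f"
  using assms by auto

lemma differentiable_upto_SucE:
  assumes "differentiable_upto (Suc k) S f"
  obtains f' where "\<And>x. x \<in> S \<Longrightarrow> (f has_derivative f' x) (at x)"
    and "\<And>v. differentiable_upto k S (\<lambda>x. f' x v)"
  using assms by auto

lemma differentiable_upto_cong:
  assumes "open S" "\<And>x. x \<in> S \<Longrightarrow> f x = g x" "differentiable_upto k S f"
  shows "differentiable_upto k S g"
proof (cases k)
  case (Suc n)
  obtain f' where f': "\<And>x. x \<in> S \<Longrightarrow> (f has_derivative f' x) (at x)"
    and *: "\<And>v. differentiable_upto n S (\<lambda>x. f' x v)"
    using assms(3) unfolding Suc by (rule differentiable_upto_SucE) blast
  have "(g has_derivative f' x) (at x)" if "x \<in> S" for x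
    using has_derivative_transform_within_open[OF f'[OF that] assms(1) that] assms(2) by simp
  with * show ?thesis
    unfolding Suc by (rule differentiable_upto_SucI[rotated])
qed simp

lemma differentiable_upto_lower:
  "differentiable_upto (Suc k) S f \<Longrightarrow> differentiable_upto k S f"
proof (induction k arbitrary: f)
  case (Suc k)
  from Suc.prems obtain f' where f': "\<And>x. x \<in> S \<Longrightarrow> (f has_derivative f' x) (at x)"
    and *: "\<And>v. differentiable_upto (Suc k) S (\<lambda>x. f' x v)"
    by (rule differentiable_upto_SucE) blast
  from f' Suc.IH[OF *] show ?case
    by (rule differentiable_upto_SucI)
qed simp

lemma differentiable_upto_const: "differentiable_upto k S (\<lambda>x. c)"
proof (induction k arbitrary: c)
  case (Suc k)
  show ?case
    by (rule differentiable_upto_SucI[where f' = "\<lambda>x v. 0"]) (auto intro: Suc)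
qed simp

lemma differentiable_upto_bounded_linear_compose:
  assumes "bounded_linear L" "differentiable_upto k S f"
  shows "differentiable_upto k S (\<lambda>x. L (f x))"
  using assms(2)
proof (induction k arbitrary: f)
  case (Suc k)
  from Suc.prems obtain f' where f': "\<And>x. x \<in> S \<Longrightarrow> (f has_derivative f' x) (at x)"
    and *: "\<And>v. differentiable_upto k S (\<lambda>x. f' x v)"
    by (rule differentiable_upto_SucE) blast
  show ?case
    by (rule differentiable_upto_SucI[where f' = "\<lambda>x v. L (f' x v)"])
       (auto intro: bounded_linear.has_derivative[OF assms(1)] f' Suc.IH *)
qed simp

lemma differentiable_upto_bounded_linear:
  assumes "bounded_linear L"
  shows "differentiable_upto k S L"
proof (cases k)
  case (Suc n)
  show ?thesis
    unfolding Suc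
    by (rule differentiable_upto_SucI[where f' = "\<lambda>x. L"])
       (auto intro: bounded_linear_imp_has_derivative assms differentiable_upto_const)
qed simp

lemma differentiable_upto_add:
  assumes "differentiable_upto k S f" "differentiable_upto k S g"
  shows "differentiable_upto k S (\<lambda>x. f x + g x)"
  using assms
proof (induction k arbitrary: f g)
  case (Suc k)
  from Suc.prems(1) obtain f' where f': "\<And>x. x \<in> S \<Longrightarrow> (f has_derivative f' x) (at x)"
    and 1: "\<And>v. differentiable_upto k S (\<lambda>x. f' x v)"
    by (rule differentiable_upto_SucE) blast
  from Suc.prems(2) obtain g' where g': "\<And>x. x \<in> S \<Longrightarrow> (g has_derivative g' x) (at x)"
    and 2: "\<And>v. differentiable_upto k S (\<lambda>x. g' x v)"
    by (rule differentiable_upto_SucE) blast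
  show ?case
    by (rule differentiable_upto_SucI[where f' = "\<lambda>x v. f' x v + g' x v"])
       (auto intro: has_derivative_add f' g' Suc.IH 1 2)
qed simp

lemma differentiable_upto_mult:
  fixes f g :: "'a::real_normed_vector \<Rightarrow> 'b::real_normed_algebra"
  assumes "differentiable_upto k S f" "differentiable_upto k S g"
  shows "differentiable_upto k S (\<lambda>x. f x * g x)"
  using assms
proof (induction k arbitrary: f g)
  case (Suc k)
  from Suc.prems(1) obtain f' where f': "\<And>x. x \<in> S \<Longrightarrow> (f has_derivative f' x) (at x)"
    and 1: "\<And>v. differentiable_upto k S (\<lambda>x. f' x v)"
    by (rule differentiable_upto_SucE) blast
  from Suc.prems(2) obtain g' where g': "\<And>x. x \<in> S \<Longrightarrow> (g has_derivative g' x) (at x)"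
    and 2: "\<And>v. differentiable_upto k S (\<lambda>x. g' x v)"
    by (rule differentiable_upto_SucE) blast
  note low = Suc.prems[THEN differentiable_upto_lower]
  show ?case
    by (rule differentiable_upto_SucI[where f' = "\<lambda>x v. f x * g' x v + f' x v * g x"])
       (auto intro!: has_derivative_mult f' g' Suc.IH 1 2 differentiable_upto_add low)
qed simp

lemma differentiable_upto_cmult:
  fixes f :: "'a::real_normed_vector \<Rightarrow> 'b::real_normed_algebra"
  shows "differentiable_upto k S f \<Longrightarrow> differentiable_upto k S (\<lambda>x. c * f x)"
  by (intro differentiable_upto_mult differentiable_upto_const)

lemma differentiable_upto_minus:
  "differentiable_upto k S f \<Longrightarrow> differentiable_upto k S (\<lambda>x. - f x)"
  by (rule differentiable_upto_bounded_linear_compose[OF bounded_linear_minus[OF bounded_linear_ident]])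

lemma differentiable_upto_diff:
  "differentiable_upto k S f \<Longrightarrow> differentiable_upto k S g \<Longrightarrow> differentiable_upto k S (\<lambda>x. f x - g x)"
  using differentiable_upto_add[OF _ differentiable_upto_minus] by fastforce

lemma differentiable_upto_divide_const:
  fixes f :: "'a::real_normed_vector \<Rightarrow> 'b::real_normed_field"
  shows "differentiable_upto k S f \<Longrightarrow> differentiable_upto k S (\<lambda>x. f x / c)"
  using differentiable_upto_mult[OF _ differentiable_upto_const, of k S f "inverse c"]
  by (simp add: divide_inverse)

lemma differentiable_upto_sum:
  "(\<And>i. i \<in> I \<Longrightarrow> differentiable_upto k S (f i)) \<Longrightarrow> differentiable_upto k S (\<lambda>x. \<Sum>i\<in>I. f i x)"
  by (induction I rule: infinite_finite_induct)
     (auto intro: differentiable_upto_add differentiable_upto_const)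

lemma differentiable_upto_inverse:
  fixes f :: "'a::real_normed_vector \<Rightarrow> real"
  assumes "differentiable_upto k S f" "\<And>x. x \<in> S \<Longrightarrow> f x \<noteq> 0"
  shows "differentiable_upto k S (\<lambda>x. inverse (f x))"
  using assms(1)
proof (induction k)
  case (Suc k)
  from Suc.prems(1) obtain f' where f': "\<And>x. x \<in> S \<Longrightarrow> (f has_derivative f' x) (at x)"
    and *: "\<And>v. differentiable_upto k S (\<lambda>x. f' x v)"
    by (rule differentiable_upto_SucE) blast
  show ?case
  proof (rule differentiable_upto_SucI)
    fix x assume "x \<in> S"
    then show "((\<lambda>x. inverse (f x)) has_derivative (\<lambda>v. - (inverse (f x) * f' x v * inverse (f x)))) (at x)"
      by (intro Deriv.has_derivative_inverse assms(2) f')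
  qed (intro differentiable_upto_minus differentiable_upto_mult * Suc.IH
        differentiable_upto_lower[OF Suc.prems])
qed simp

text \<open>The derivative \<open>f' / f\<close> is a product of functions of one order less.\<close>

lemma differentiable_upto_ln:
  fixes f :: "'a::real_normed_vector \<Rightarrow> real"
  assumes "differentiable_upto k S f" "\<And>x. x \<in> S \<Longrightarrow> f x > 0"
  shows "differentiable_upto k S (\<lambda>x. ln (f x))"
proof (cases k)
  case (Suc n)
  obtain f' where f': "\<And>x. x \<in> S \<Longrightarrow> (f has_derivative f' x) (at x)"
    and *: "\<And>v. differentiable_upto n S (\<lambda>x. f' x v)"
    using assms(1) unfolding Suc by (rule differentiable_upto_SucE) blast
  have f: "differentiable_upto n S f"
    using assms(1) unfolding Suc by (rule differentiable_upto_lower)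
  show ?thesis
    unfolding Suc
  proof (rule differentiable_upto_SucI)
    fix x assume "x \<in> S"
    then show "((\<lambda>x. ln (f x)) has_derivative (\<lambda>v. f' x v * inverse (f x))) (at x)"
      using assms(2) f' by (auto intro!: derivative_eq_intros simp: divide_inverse mult.commute)
  next
    show "differentiable_upto n S (\<lambda>x. f' x v * inverse (f x))" for v
      using assms(2) by (intro differentiable_upto_mult * differentiable_upto_inverse f) force
  qed
qed simp

lemmas differentiable_upto_intros = differentiable_upto_const differentiable_upto_add
  differentiable_upto_diff differentiable_upto_minus differentiable_upto_mult
  differentiable_upto_divide_const differentiable_upto_sum

lemma differentiable_upto_dir_deriv:
  assumes "open S" "differentiable_upto (Suc k) S f"
  shows "differentiable_upto k S (\<lambda>q. dir_deriv f q v)"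
proof -
  from assms(2) obtain f' where f': "\<And>x. x \<in> S \<Longrightarrow> (f has_derivative f' x) (at x)"
    and *: "\<And>v. differentiable_upto k S (\<lambda>x. f' x v)"
    by (rule differentiable_upto_SucE) blast
  show ?thesis
    by (rule differentiable_upto_cong[OF assms(1) _ *[of v]]) (simp add: dir_deriv_eq[OF f'])
qed

lemma differentiable_upto_del:
  assumes "open S" "differentiable_upto (Suc k) S f"
  shows "differentiable_upto k S (\<lambda>q. del f q v)"
    and "differentiable_upto k S (\<lambda>q. delbar f q v)"
  unfolding del_def delbar_def
  by (intro differentiable_upto_intros differentiable_upto_dir_deriv assms)+

lemma dir_deriv_add:
  assumes "differentiable_upto (Suc k) S f" "p \<in> S"
  shows "dir_deriv f p (v + w) = dir_deriv f p v + dir_deriv f p w"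
proof -
  obtain f' where f': "(f has_derivative f') (at p)"
    using assms by auto
  show ?thesis
    by (simp add: dir_deriv_eq[OF f'] linear_add[OF has_derivative_linear[OF f']])
qed

lemma dir_deriv_fun_add:
  assumes "differentiable_upto (Suc k) S f" "differentiable_upto (Suc k) S g" "p \<in> S"
  shows "dir_deriv (\<lambda>q. f q + g q) p v = dir_deriv f p v + dir_deriv g p v"
proof -
  obtain f' where f': "(f has_derivative f') (at p)"
    using assms by auto
  obtain g' where g': "(g has_derivative g') (at p)"
    using assms by auto
  show ?thesis
    by (simp add: dir_deriv_eq[OF f'] dir_deriv_eq[OF g'] dir_deriv_eq[OF has_derivative_add[OF f' g']])
qed

section \<open>Kaehler metrics and their Christoffel symbols\<close>

lemma del_add:
  assumes "differentiable_upto (Suc k) S f" "p \<in> S"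
  shows "del f p (v + w) = del f p v + del f p w"
    and "delbar f p (v + w) = delbar f p v + delbar f p w"
  unfolding del_def delbar_def
  by (simp_all add: dir_deriv_add[OF assms] ring_distribs add_divide_distrib diff_divide_distrib)

lemma del_fun_add:
  assumes "differentiable_upto (Suc k) S f" "differentiable_upto (Suc k) S g" "p \<in> S"
  shows "del (\<lambda>q. f q + g q) p v = del f p v + del g p v"
  unfolding del_def
  by (simp add: dir_deriv_fun_add[OF assms] ring_distribs add_divide_distrib diff_divide_distrib)

text \<open>In \<open>\<partial>\<partial>\<^sup>-\<psi>(u, v)\<close> the direction \<open>v\<close> occurs once in an inner derivative, where additivity
  holds at all points near \<open>p\<close> and can be differentiated, and once in an outer one.
  Two derivatives of the potential suffice for both.\<close>

lemma kaehler_metric_add_right: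
  assumes "open S" "differentiable_upto 2 S \<phi>" "\<And>q. q \<in> S \<Longrightarrow> \<phi> q > 0" "p \<in> S"
  shows "kaehler_metric \<phi> p u (v + w) = kaehler_metric \<phi> p u v + kaehler_metric \<phi> p u w"
proof -
  define \<psi> where "\<psi> = (\<lambda>q. complex_of_real (ln (\<phi> q)))"
  have \<psi>: "differentiable_upto (Suc (Suc 0)) S \<psi>"
    unfolding \<psi>_def using assms
    by (intro differentiable_upto_bounded_linear_compose[OF bounded_linear_of_real]
        differentiable_upto_ln) (simp_all add: numeral_2_eq_2)
  have delbar: "differentiable_upto (Suc 0) S (\<lambda>q. delbar \<psi> q x)" for x
    by (rule differentiable_upto_del(2)[OF assms(1) \<psi>])
  have "del_delbar \<psi> p u (x + y) = del_delbar \<psi> p u x + del_delbar \<psi> p u y" for x y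
  proof -
    have "del (\<lambda>q. delbar \<psi> q (x + y)) p u = del (\<lambda>q. delbar \<psi> q x + delbar \<psi> q y) p u"
      by (rule del_cong(1)[OF assms(1,4)]) (rule del_add(2)[OF \<psi>])
    then show ?thesis
      by (simp add: del_delbar_def del_fun_add[OF delbar delbar assms(4)]
          del_add(1)[OF delbar assms(4)])
  qed
  then show ?thesis
    by (simp add: kaehler_metric_def kaehler_form_def algebra_simps
        flip: \<psi>_def)
qed

lemma differentiable_upto_kaehler_metric:
  assumes "open S" "differentiable_upto (Suc (Suc k)) S \<phi>" "\<And>q. q \<in> S \<Longrightarrow> \<phi> q > 0"
  shows "differentiable_upto k S (\<lambda>q. kaehler_metric \<phi> q u v)"
proof -
  have \<psi>: "differentiable_upto (Suc (Suc k)) S (\<lambda>q. complex_of_real (ln (\<phi> q)))"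
    using assms
    by (intro differentiable_upto_bounded_linear_compose[OF bounded_linear_of_real]
        differentiable_upto_ln)
  show ?thesis
    unfolding kaehler_metric_def kaehler_form_def del_delbar_def
    by (intro differentiable_upto_bounded_linear_compose[OF bounded_linear_Re]
        differentiable_upto_cmult differentiable_upto_diff differentiable_upto_del \<psi> assms(1))
qed

text \<open>The Christoffel symbol differentiates the metric once more, along the third argument in
  one of its terms, which accounts for the order three.\<close>

lemma christoffel_add_right:
  assumes "open S" "differentiable_upto 3 S \<phi>" "\<And>q. q \<in> S \<Longrightarrow> \<phi> q > 0" "p \<in> S"
  shows "christoffel (kaehler_metric \<phi>) p a b (c + d)
       = christoffel (kaehler_metric \<phi>) p a b c + christoffel (kaehler_metric \<phi>) p a b d"
proof -
  let ?g = "kaehler_metric \<phi>"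
  have \<phi>: "differentiable_upto (Suc (Suc (Suc 0))) S \<phi>"
    using assms(2) by (simp add: numeral_3_eq_3)
  note g = differentiable_upto_kaehler_metric[OF assms(1) \<phi> assms(3)]
  have add: "?g q x (c + d) = ?g q x c + ?g q x d" if "q \<in> S" for q x
    using kaehler_metric_add_right[OF assms(1) _ assms(3) that]
      differentiable_upto_lower[OF \<phi>] by (simp add: numeral_2_eq_2)
  have "dir_deriv (\<lambda>q. ?g q x (c + d)) p y
      = dir_deriv (\<lambda>q. ?g q x c) p y + dir_deriv (\<lambda>q. ?g q x d) p y" for x y
    using dir_deriv_cong[OF assms(1,4) add] by (simp add: dir_deriv_fun_add[OF g g assms(4)])
  then show ?thesis
    by (simp add: christoffel_def dir_deriv_add[OF g assms(4)] add_divide_distrib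
        diff_divide_distrib)
qed

section \<open>Pulling back along complex linear maps\<close>

abbreviation complex_linear :: "(complex ^ 'n \<Rightarrow> complex ^ 'm) \<Rightarrow> bool" where
  "complex_linear \<equiv> Vector_Spaces.linear (*s) (*s)"

lemma scaleR_vec_complex: "t *\<^sub>R v = complex_of_real t *s (v :: complex ^ 'n)"
  unfolding vec_eq_iff vector_scaleR_component vector_smult_component
  by (simp add: scaleR_conv_of_real)

lemma complex_linear_imp_linear: "complex_linear L \<Longrightarrow> linear L"
  by (auto intro!: linearI simp: vec.linear_add vec.linear_scale scaleR_vec_complex)

lemma complex_linear_has_derivative:
  assumes "complex_linear L"
  shows "(L has_derivative L) (at p)"
  using bounded_linear_imp_has_derivative linear_conv_bounded_linear
    complex_linear_imp_linear[OF assms] by blast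

lemma complex_linear_dir_deriv: "complex_linear L \<Longrightarrow> dir_deriv L p v = L v"
  by (rule dir_deriv_eq[OF complex_linear_has_derivative])

lemma dir_deriv_compose_linear:
  assumes "complex_linear L"
  shows "dir_deriv (\<lambda>q. f (L q)) p v = dir_deriv f (L p) (L v)"
  by (simp add: dir_deriv_def scaleR_vec_complex vec.linear_add[OF assms] vec.linear_scale[OF assms])

lemma kaehler_metric_compose_linear:
  assumes "complex_linear L"
  shows "kaehler_metric (\<lambda>q. \<phi> (L q)) p u v = kaehler_metric \<phi> (L p) (L u) (L v)"
proof -
  have delbar: "delbar (\<lambda>q. f (L q)) q w = delbar f (L q) (L w)" for f q w
    by (simp add: delbar_def dir_deriv_compose_linear[OF assms] vec.linear_scale[OF assms])
  have del: "del (\<lambda>q. delbar f (L q) x) q w = del (\<lambda>q. delbar f q x) (L q) (L w)" for f q w x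
    by (simp add: del_def dir_deriv_compose_linear[OF assms, of "\<lambda>q. delbar f q x"]
        vec.linear_scale[OF assms])
  show ?thesis
    by (simp add: kaehler_metric_def kaehler_form_def del_delbar_def del vec.linear_scale[OF assms]
        delbar[of "\<lambda>q. complex_of_real (ln (\<phi> q))"])
qed

lemma christoffel_compose_linear:
  assumes "complex_linear L"
  shows "christoffel (kaehler_metric (\<lambda>q. \<phi> (L q))) p a b c
       = christoffel (kaehler_metric \<phi>) (L p) (L a) (L b) (L c)"
  by (simp add: christoffel_def kaehler_metric_compose_linear[OF assms]
      dir_deriv_compose_linear[OF assms, of "\<lambda>q. kaehler_metric \<phi> q x y" for x y])

text \<open>The substitutions \<open>L\<close> and \<open>M\<close> give the same potential, so they give the same metric and
  Christoffel symbols. Comparing the two pull-backs at \<open>p\<close> shows invariance under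
  \<open>\<xi> \<mapsto> - \<xi>\<close>, which together with additivity forces the value zero. Two maps are used
  instead of one symmetry in order to cover potentials which are symmetric only on a subspace:
  there \<open>L\<close> is a projection onto this subspace and \<open>M\<close> is that projection followed by the
  symmetry.\<close>

lemma mirrored_direction_is_normal:
  assumes "open S" "differentiable_upto 3 S \<phi>" "\<And>q. q \<in> S \<Longrightarrow> \<phi> q > 0" "p \<in> S"
    and L: "complex_linear L" "complex_linear M" "\<And>q. \<phi> (L q) = \<phi> (M q)"
    and fixed: "\<And>x. x \<in> {p, u, v} \<Longrightarrow> L x = x \<and> M x = x"
    and mirrored: "L \<xi> = \<xi>" "M \<xi> = - \<xi>"
  shows "kaehler_metric \<phi> p u \<xi> = 0" "christoffel (kaehler_metric \<phi>) p u v \<xi> = 0"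
proof -
  have \<phi>: "differentiable_upto 2 S \<phi>"
    by (rule differentiable_upto_lower) (use assms(2) in \<open>simp add: eval_nat_numeral\<close>)
  have eq: "(\<lambda>q. \<phi> (L q)) = (\<lambda>q. \<phi> (M q))"
    using L(3) by blast
  have "kaehler_metric \<phi> p u \<xi> = kaehler_metric \<phi> p u (- \<xi>)"
    using kaehler_metric_compose_linear[OF L(1), of \<phi> p u \<xi>]
      kaehler_metric_compose_linear[OF L(2), of \<phi> p u \<xi>] fixed mirrored eq by simp
  moreover have "kaehler_metric \<phi> p u (\<xi> + - \<xi>) = kaehler_metric \<phi> p u \<xi> + kaehler_metric \<phi> p u (- \<xi>)"
    by (rule kaehler_metric_add_right[OF assms(1) \<phi> assms(3,4)])
  moreover have "kaehler_metric \<phi> p u (0 + 0) = kaehler_metric \<phi> p u 0 + kaehler_metric \<phi> p u 0"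
    by (rule kaehler_metric_add_right[OF assms(1) \<phi> assms(3,4)])
  ultimately show "kaehler_metric \<phi> p u \<xi> = 0" by simp
  let ?\<Gamma> = "christoffel (kaehler_metric \<phi>) p u v"
  have "?\<Gamma> \<xi> = ?\<Gamma> (- \<xi>)"
    using christoffel_compose_linear[OF L(1), of \<phi> p u v \<xi>]
      christoffel_compose_linear[OF L(2), of \<phi> p u v \<xi>] fixed mirrored eq by simp
  moreover have "?\<Gamma> (\<xi> + - \<xi>) = ?\<Gamma> \<xi> + ?\<Gamma> (- \<xi>)"
    by (rule christoffel_add_right[OF assms(1-4)])
  moreover have "?\<Gamma> (0 + 0) = ?\<Gamma> 0 + ?\<Gamma> 0"
    by (rule christoffel_add_right[OF assms(1-4)])
  ultimately show "?\<Gamma> \<xi> = 0" by simp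
qed

section \<open>The metric of the polydisk\<close>

lemma open_polydisk: "open (polydisk :: (complex ^ 'k) set)"
proof -
  have "open (\<Inter>j\<in>UNIV. {z :: complex ^ 'k. cmod (z $ j) < 1})"
    by (intro open_INT ballI open_Collect_less continuous_intros) simp
  then show ?thesis
    by (simp add: polydisk_def Collect_all_eq)
qed

lemma cmod_less_1_iff: "cmod z < 1 \<longleftrightarrow> (cmod z)\<^sup>2 < 1"
  by (metis abs_norm_cancel abs_square_less_1)

text \<open>Each factor contributes the Poincare metric: the mixed derivative of
  \<open>log (1 - |q|\<^sup>2)\<close> is \<open>- (1 - |q|\<^sup>2)\<^sup>-\<^sup>2\<close>, obtained below from the intermediate
  \<open>\<partial>\<^sup>-\<close>-derivative \<open>- q / (1 - |q|\<^sup>2)\<close>.\<close>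

lemma g_polydisk_eq:
  fixes p :: "complex ^ 'k"
  assumes "p \<in> polydisk"
  shows "g_polydisk p u v = (\<Sum>j\<in>UNIV. Re (u $ j * cnj (v $ j)) / (1 - (cmod (p $ j))\<^sup>2)\<^sup>2)"
proof -
  define N where "N = (\<lambda>(q :: complex ^ 'k) j. 1 - (cmod (q $ j))\<^sup>2)"
  have N_pos: "N q j > 0" if "q \<in> polydisk" for q j
    using that by (simp add: N_def polydisk_def flip: cmod_less_1_iff)
  define \<psi> where "\<psi> = (\<lambda>q. complex_of_real (ln (\<Prod>j\<in>UNIV. N q j)))"
  \<comment> \<open>\<open>R q v j\<close> is the real inner product of the \<open>j\<close>-th components.\<close>
  define R where "R = (\<lambda>(q :: complex ^ 'k) v j. Re (q $ j) * Re (v $ j) + Im (q $ j) * Im (v $ j))"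
  have N_deriv: "((\<lambda>t. N (q + t *\<^sub>R w) j) has_real_derivative - 2 * R q w j) (at 0)" for q w j
    unfolding N_def R_def cmod_power2
    by (auto intro!: derivative_eq_intros simp: algebra_simps)
  have \<psi>_deriv: "dir_deriv \<psi> q w = (\<Sum>j\<in>UNIV. - 2 * R q w j / N q j)" if "q \<in> polydisk" for q w
  proof -
    have "dir_deriv \<psi> q w = dir_deriv (\<lambda>q. complex_of_real (\<Sum>j\<in>UNIV. ln (N q j))) q w"
      by (rule dir_deriv_cong[OF open_polydisk that])
         (simp add: \<psi>_def ln_prod[OF finite less_imp_neq[OF N_pos, symmetric]])
    also have "\<dots> = complex_of_real (\<Sum>j\<in>UNIV. - 2 * R q w j / N q j)"
      unfolding dir_deriv_def
      using N_pos[OF that]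
      by (intro vector_derivative_at has_vector_derivative_of_real)
         (auto intro!: derivative_eq_intros N_deriv
           simp: divide_inverse mult_ac simp flip: has_real_derivative_iff_has_vector_derivative)
    finally show ?thesis by simp
  qed
  have delbar: "delbar \<psi> q w = (\<Sum>j\<in>UNIV. - (q $ j * cnj (w $ j)) / N q j)" if "q \<in> polydisk" for q w
  proof -
    have "delbar \<psi> q w = (\<Sum>j\<in>UNIV. (- 2 * R q w j / N q j + \<i> * (- 2 * R q (\<i> *s w) j / N q j)) / 2)"
      by (simp only: of_real_sum delbar_def \<psi>_deriv[OF that] sum_distrib_left sum_divide_distrib sum.distrib[symmetric])
    also have "\<dots> = (\<Sum>j\<in>UNIV. - (q $ j * cnj (w $ j)) / N q j)"
      by (rule sum.cong) (auto simp: R_def complex_eq_iff add_divide_distrib diff_divide_distrib)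
    finally show ?thesis .
  qed
  have del: "del (\<lambda>q. delbar \<psi> q w) p x = (\<Sum>j\<in>UNIV. - (x $ j * cnj (w $ j)) / (N p j)\<^sup>2)" for w x
  proof -
    define D where "D = (\<lambda>(y :: complex ^ 'k) j.
      - (y $ j * cnj (w $ j)) / N p j - p $ j * cnj (w $ j) * (2 * R p y j / (N p j)\<^sup>2))"
    have "((\<lambda>t. - ((p + t *\<^sub>R y) $ j * cnj (w $ j)) / complex_of_real (N (p + t *\<^sub>R y) j))
       has_vector_derivative D y j) (at 0)" for y j
    proof -
      have num: "((\<lambda>t. - ((p + t *\<^sub>R y) $ j * cnj (w $ j))) has_vector_derivative - (y $ j * cnj (w $ j))) (at 0)"
        by (auto intro!: derivative_eq_intros)
      have "((\<lambda>t. inverse (N (p + t *\<^sub>R y) j)) has_real_derivative 2 * R p y j / (N p j)\<^sup>2) (at 0)"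
        using N_pos[OF assms, of j]
        by (auto intro!: derivative_eq_intros N_deriv simp: divide_inverse power2_eq_square)
      then have den: "((\<lambda>t. complex_of_real (inverse (N (p + t *\<^sub>R y) j))) has_vector_derivative
          complex_of_real (2 * R p y j / (N p j)\<^sup>2)) (at 0)"
        by (intro has_vector_derivative_of_real) (simp add: has_real_derivative_iff_has_vector_derivative)
      show ?thesis
        using has_vector_derivative_mult[OF num den]
        by (simp add: D_def divide_inverse algebra_simps)
    qed
    then have "dir_deriv (\<lambda>q. \<Sum>j\<in>UNIV. - (q $ j * cnj (w $ j)) / N q j) p y = (\<Sum>j\<in>UNIV. D y j)" for y
      unfolding dir_deriv_def
      by (intro vector_derivative_at has_vector_derivative_sum)
    moreover have "del (\<lambda>q. delbar \<psi> q w) p x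
        = del (\<lambda>q. \<Sum>j\<in>UNIV. - (q $ j * cnj (w $ j)) / N q j) p x"
      by (rule del_cong(1)[OF open_polydisk assms]) (rule delbar)
    ultimately have "del (\<lambda>q. delbar \<psi> q w) p x = (\<Sum>j\<in>UNIV. (D x j - \<i> * D (\<i> *s x) j) / 2)"
      by (simp only: del_def sum_distrib_left sum_subtractf sum_divide_distrib[symmetric])
    also have "\<dots> = (\<Sum>j\<in>UNIV. - (x $ j * cnj (w $ j)) / (N p j)\<^sup>2)"
    proof (rule sum.cong)
      fix j
      \<comment> \<open>Only the complex linear part of the real inner product survives.\<close>
      have R: "R p x j - \<i> * R p (\<i> *s x) j = cnj (p $ j) * x $ j"
        by (simp add: R_def complex_eq_iff)
      have norm_sq: "p $ j * cnj (p $ j) = 1 - N p j"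
        by (simp add: N_def complex_norm_square[symmetric])
      have "(D x j - \<i> * D (\<i> *s x) j) / 2
          = - (x $ j * cnj (w $ j)) / N p j
            - p $ j * cnj (w $ j) * ((R p x j - \<i> * R p (\<i> *s x) j) / (N p j)\<^sup>2)"
        using N_pos[OF assms, of j] by (simp add: D_def field_simps power2_eq_square)
      also have "\<dots> = - (x $ j * cnj (w $ j)) / N p j
            - x $ j * cnj (w $ j) * ((1 - N p j) / (N p j)\<^sup>2)"
        unfolding R using norm_sq by simp
      also have "\<dots> = - (x $ j * cnj (w $ j)) / (N p j)\<^sup>2"
        using N_pos[OF assms, of j] by (simp add: field_simps power2_eq_square)
      finally show "(D x j - \<i> * D (\<i> *s x) j) / 2 = - (x $ j * cnj (w $ j)) / (N p j)\<^sup>2" .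
    qed simp
    finally show ?thesis .
  qed
  have "g_polydisk p u v = Re (- (\<i> / 2) *
      (del (\<lambda>q. delbar \<psi> q (\<i> *s v)) p u - del (\<lambda>q. delbar \<psi> q u) p (\<i> *s v)))"
    by (simp add: g_polydisk_def kaehler_metric_def kaehler_form_def del_delbar_def \<psi>_def N_def)
  also have "\<dots> = Re (\<Sum>j\<in>UNIV. complex_of_real (Re (u $ j * cnj (v $ j)) / (N p j)\<^sup>2))"
    unfolding del sum_subtractf[symmetric] sum_distrib_left
  proof (intro arg_cong[where f = Re] sum.cong)
    fix j
    have "\<i> / 2 * (u $ j * cnj (\<i> * v $ j) - \<i> * v $ j * cnj (u $ j)) = Re (u $ j * cnj (v $ j))"
      by (simp add: complex_eq_iff)
    moreover have "- (\<i> / 2) * (- a / c - - b / c) = (\<i> / 2 * (a - b)) / c" for a b c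
      by (simp add: diff_divide_distrib right_diff_distrib)
    ultimately show "- (\<i> / 2) * (- (u $ j * cnj ((\<i> *s v) $ j)) / (N p j)\<^sup>2
        - - ((\<i> *s v) $ j * cnj (u $ j)) / (N p j)\<^sup>2) = Re (u $ j * cnj (v $ j)) / (N p j)\<^sup>2"
      by (simp only: vector_smult_component of_real_divide)
  qed simp
  finally show ?thesis
    by (simp add: N_def)
qed

section \<open>The generic norm on the space of the domain of type V\<close>

lemma sc_mkH [simp]:
  "sc (mkH a b c A B C) 1 = a" "sc (mkH a b c A B C) 2 = b" "sc (mkH a b c A B C) 3 = c"
  by (simp_all add: sc_def mkH_def)

lemma oc_mkH [simp]:
  "oc (mkH a b c A B C) 1 = A" "oc (mkH a b c A B C) 2 = B" "oc (mkH a b c A B C) 3 = C"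
  by (simp_all add: oc_def mkH_def vec_eq_iff)

lemma herm3_eqI:
  assumes "\<And>j. sc z j = sc w j" "\<And>j. oc z j = oc w j"
  shows "z = w"
  unfolding vec_eq_iff
proof
  fix i :: "3 + 3 \<times> 8"
  show "z $ i = w $ i"
  proof (cases i)
    case (Inl j)
    with assms(1)[of j] show ?thesis by (simp add: sc_def)
  next
    case (Inr jk)
    with assms(2)[of "fst jk"] show ?thesis by (cases jk) (simp add: oc_def vec_eq_iff)
  qed
qed

lemma mkH_eq_iff:
  "z = mkH a b c A B C \<longleftrightarrow>
     sc z 1 = a \<and> sc z 2 = b \<and> sc z 3 = c \<and> oc z 1 = A \<and> oc z 2 = B \<and> oc z 3 = C"
proof (intro iffI herm3_eqI)
  fix j
  assume *: "sc z 1 = a \<and> sc z 2 = b \<and> sc z 3 = c \<and> oc z 1 = A \<and> oc z 2 = B \<and> oc z 3 = C"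
  from * show "sc z j = sc (mkH a b c A B C) j"
    using exhaust_3[of j] by auto
  from * show "oc z j = oc (mkH a b c A B C) j"
    using exhaust_3[of j] by auto
qed auto

lemma sc_linear [simp]:
  "sc (z + w) j = sc z j + sc w j" "sc (c *s z) j = c * sc z j" "sc (- z) j = - sc z j"
  by (simp_all add: sc_def)

lemma oc_linear [simp]:
  "oc (z + w) j = oc z j + oc w j" "oc (c *s z) j = c *s oc z j" "oc (- z) j = - oc z j"
  by (simp_all add: oc_def vec_eq_iff)

lemma vcnj_0 [simp]: "vcnj 0 = 0"
  by (simp add: vcnj_def vec_eq_iff)

lemma cbil_0 [simp]: "cbil 0 z = 0" "cbil z 0 = 0"
  by (simp_all add: cbil_def)

lemma oct_mult_0 [simp]: "0 \<odot> Z = 0" "Z \<odot> 0 = 0"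
  by (simp_all add: oct_mult_def cayley_cross_def vec_eq_iff Let_def)

lemma oct_mult_minus_right: "Z \<odot> (- W) = - (Z \<odot> W)"
  by (simp add: oct_mult_def cayley_cross_def vec_eq_iff Let_def sum_negf)

lemma oct_mult_scale: "(c *s Z) \<odot> (d *s W) = (c * d) *s (Z \<odot> W)"
  by (simp add: oct_mult_def cayley_cross_def vec_eq_iff Let_def sum_distrib_left algebra_simps)

lemma cbil_scale: "cbil (c *s z) (d *s w) = c * d * cbil z w"
  by (simp add: cbil_def sum_distrib_left mult_ac)

lemma cbil_scale_left: "cbil (c *s z) w = c * cbil z w"
  by (simp add: cbil_def sum_distrib_left mult_ac)

lemma cbil_minus: "cbil (- z) (- w) = cbil z w"
  by (simp add: cbil_def)

lemma vcnj_minus: "vcnj (- z) = - vcnj z"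
  by (simp add: vcnj_def vec_eq_iff)

text \<open>The units \<open>1\<close> and \<open>e\<^sub>1\<close> are orthonormal for the bilinear form.\<close>

lemma cbil_span_1_e1:
  "cbil (a *s axis 0 1 + b *s axis 1 1 :: octc) (c *s axis 0 1 + d *s axis 1 1) = a * c + b * d"
proof -
  let ?z = "a *s axis 0 1 + b *s axis 1 1 :: octc" and ?w = "c *s axis 0 1 + d *s axis 1 1 :: octc"
  have "cbil ?z ?w = (\<Sum>k\<in>{0, 1}. ?z $ k * ?w $ k)"
    unfolding cbil_def by (rule sum.mono_neutral_right) (auto simp: axis_def)
  then show ?thesis
    by (simp add: axis_def)
qed

lemma hform_eq:
  "hform x y = sc x 1 * cnj (sc y 1) + sc x 2 * cnj (sc y 2) + sc x 3 * cnj (sc y 3)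
     + cbil (oc x 1) (vcnj (oc y 1)) + cbil (oc x 2) (vcnj (oc y 2)) + cbil (oc x 3) (vcnj (oc y 3))"
  by (simp add: hform_def sum_3)

lemma sharp_mkH_Hprime:
  "sharp (mkH 0 0 0 0 A B) = mkH 0 (- (cbil A A / 2)) (- (cbil B B / 2)) (A \<odot> B) 0 0"
  by (simp add: sharp_def)

lemma N_V_mkH:
  "N_V (mkH 0 0 0 0 A B) (mkH 0 0 0 0 A' B') =
     1 - (cbil A (vcnj A') + cbil B (vcnj B'))
     + (cbil A A * cnj (cbil A' A') + cbil B B * cnj (cbil B' B')) / 4
     + cbil (A \<odot> B) (vcnj (A' \<odot> B'))"
  by (simp add: N_V_def sharp_mkH_Hprime hform_eq add_divide_distrib)

text \<open>The cubic form vanishes on \<open>Hprime\<close>: the entries where the adjoint is nonzero are the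
  entries where elements of \<open>Hprime\<close> are zero.\<close>

lemma hform_sharp_vcnj_Hprime: "hform (sharp (mkH 0 0 0 0 A B)) (vcnj (mkH 0 0 0 0 A B)) = 0"
proof -
  have "sc (vcnj z) j = cnj (sc z j)" "oc (vcnj z) j = vcnj (oc z j)" for z :: herm3 and j
    by (simp_all add: sc_def oc_def vcnj_def vec_eq_iff)
  then show ?thesis
    by (simp add: sharp_mkH_Hprime hform_eq)
qed

lemma N_V_scale: "N_V (t *s z) w = 1 - t * hform z w + t\<^sup>2 * hform (sharp z) (sharp w)"
proof -
  have "t\<^sup>2 *s sharp z = sharp (t *s z)"
    unfolding sharp_def[of "t *s z"] mkH_eq_iff
    by (simp add: sharp_def cbil_scale oct_mult_scale cayley_cnj_def vec_eq_iff power2_eq_square algebra_simps)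
  then have "sharp (t *s z) = t\<^sup>2 *s sharp z" ..
  moreover have "hform (c *s x) y = c * hform x y" for c x y
    by (simp add: hform_eq cbil_scale_left algebra_simps)
  ultimately show ?thesis
    by (simp add: N_V_def)
qed

text \<open>The degree two is attained at the octonion unit in the second entry, where
  \<open>(z\<^sup>\<sharp> | z\<^sup>\<sharp>) = |\<langle>1, 1\<rangle>|\<^sup>2 / 4 \<noteq> 0\<close>.\<close>

lemma generic_norm_rank_V: "generic_norm_rank Hprime N_V = 2"
proof -
  let ?p = "\<lambda>z w. [:1, - hform z w, hform (sharp z) (sharp w):]"
  let ?D = "{degree p | p z w. z \<in> Hprime \<and> w \<in> Hprime \<and> (\<forall>t. poly p t = N_V (t *s z) w)}"
  have p: "poly (?p z w) t = N_V (t *s z) w" for z w t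
    by (simp add: N_V_scale power2_eq_square algebra_simps)
  have le: "d \<le> 2" if "d \<in> ?D" for d
  proof -
    from that obtain q z w where q: "d = degree q" "\<forall>t. poly q t = N_V (t *s z) w"
      by blast
    then have "poly q = poly (?p z w)"
      unfolding fun_eq_iff p by blast
    then show ?thesis
      using q(1) by (simp add: poly_eq_poly_eq_iff)
  qed
  define e :: herm3 where "e = mkH 0 0 0 0 (axis 0 1) 0"
  have "cbil (axis 0 1 :: octc) (axis 0 1) = 1"
    using cbil_span_1_e1[of 1 0 1 0] by simp
  then have "hform (sharp e) (sharp e) \<noteq> 0"
    by (simp add: e_def sharp_mkH_Hprime hform_eq)
  then have "degree (?p e e) = 2"
    by simp
  moreover have "e \<in> Hprime"
    by (auto simp: e_def Hprime_def)
  ultimately have "2 \<in> ?D"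
    using p[of e e] by (intro CollectI exI[of _ "?p e e"] exI[of _ e]) simp
  moreover have "finite ?D"
    using le by (intro finite_subset[of ?D "{..2}"]) auto
  ultimately show ?thesis
    unfolding generic_norm_rank_def using le by (intro Max_eqI) auto
qed

section \<open>Smoothness of the generic norm\<close>

lemma differentiable_upto_sc: "differentiable_upto k S (\<lambda>z. sc z j)"
  unfolding sc_def by (intro differentiable_upto_bounded_linear bounded_linear_vec_nth)

lemma differentiable_upto_oc: "differentiable_upto k S (\<lambda>z. oc z j $ i)"
  unfolding oc_def by (simp add: differentiable_upto_bounded_linear bounded_linear_vec_nth)

lemma differentiable_upto_cnj:
  "differentiable_upto k S f \<Longrightarrow> differentiable_upto k S (\<lambda>z. cnj (f z))"
  by (rule differentiable_upto_bounded_linear_compose[OF bounded_linear_cnj])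

lemma differentiable_upto_cbil:
  assumes "\<And>i. differentiable_upto k S (\<lambda>z. F z $ i)" "\<And>i. differentiable_upto k S (\<lambda>z. G z $ i)"
  shows "differentiable_upto k S (\<lambda>z. cbil (F z) (G z))"
  unfolding cbil_def by (intro differentiable_upto_intros assms)

lemma differentiable_upto_oct_mult:
  assumes "\<And>i. differentiable_upto k S (\<lambda>z. F z $ i)" "\<And>i. differentiable_upto k S (\<lambda>z. G z $ i)"
  shows "differentiable_upto k S (\<lambda>z. (F z \<odot> G z) $ i)"
proof -
  have cases: "differentiable_upto k S (\<lambda>z. if P then f z else g z)"
    if "differentiable_upto k S f" "differentiable_upto k S g" for P and f g :: "'a \<Rightarrow> complex"
    using that by (cases P) auto
  show ?thesis
    unfolding oct_mult_def cayley_cross_def Let_def vec_lambda_beta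
    by (intro cases differentiable_upto_intros assms)
qed

lemma differentiable_upto_hform:
  assumes "\<And>j. differentiable_upto k S (\<lambda>z. sc (F z) j)" "\<And>j i. differentiable_upto k S (\<lambda>z. oc (F z) j $ i)"
    and "\<And>j. differentiable_upto k S (\<lambda>z. sc (G z) j)" "\<And>j i. differentiable_upto k S (\<lambda>z. oc (G z) j $ i)"
  shows "differentiable_upto k S (\<lambda>z. hform (F z) (G z))"
  unfolding hform_eq vcnj_def
  by (intro differentiable_upto_intros differentiable_upto_cbil differentiable_upto_cnj assms
      | simp only: vec_lambda_beta)+

lemma differentiable_upto_sharp:
  shows "differentiable_upto k S (\<lambda>z. sc (sharp z) j)" "differentiable_upto k S (\<lambda>z. oc (sharp z) j $ i)"
proof -
  have cayley: "differentiable_upto k S (\<lambda>z. cayley_cnj (oc z j) $ i)" for j i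
    by (cases "i = 0") (auto simp: cayley_cnj_def intro!: differentiable_upto_intros differentiable_upto_oc)
  show "differentiable_upto k S (\<lambda>z. sc (sharp z) j)"
    using exhaust_3[of j]
    by (auto simp: sharp_def intro!: differentiable_upto_intros differentiable_upto_cbil differentiable_upto_sc differentiable_upto_oc)
  show "differentiable_upto k S (\<lambda>z. oc (sharp z) j $ i)"
    using exhaust_3[of j]
    by (auto simp: sharp_def intro!: differentiable_upto_intros differentiable_upto_oct_mult cayley
        differentiable_upto_sc differentiable_upto_oc)
qed

lemma differentiable_upto_N_V: "differentiable_upto k S (\<lambda>z. Re (N_V z z))"
  unfolding N_V_def
  by (intro differentiable_upto_bounded_linear_compose[OF bounded_linear_Re] differentiable_upto_intros
      differentiable_upto_hform differentiable_upto_sharp differentiable_upto_sc differentiable_upto_oc)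

section \<open>The embedding of the bidisk\<close>

lemma complex_linear_mkH:
  assumes "complex_linear (\<lambda>z. A z)" "complex_linear (\<lambda>z. B z)"
  shows "complex_linear (\<lambda>z. mkH 0 0 0 0 (A z) (B z))"
proof (unfold_locales)
  fix x y :: "complex ^ 'a" and c
  have "mkH 0 0 0 0 (A x) (B x) + mkH 0 0 0 0 (A y) (B y) = mkH 0 0 0 0 (A (x + y)) (B (x + y))"
    by (simp add: mkH_eq_iff vec.linear_add[OF assms(1)] vec.linear_add[OF assms(2)])
  then show "mkH 0 0 0 0 (A (x + y)) (B (x + y)) = mkH 0 0 0 0 (A x) (B x) + mkH 0 0 0 0 (A y) (B y)" ..
  have "c *s mkH 0 0 0 0 (A x) (B x) = mkH 0 0 0 0 (A (c *s x)) (B (c *s x))"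
    by (simp add: mkH_eq_iff vec.linear_scale[OF assms(1)] vec.linear_scale[OF assms(2)])
  then show "mkH 0 0 0 0 (A (c *s x)) (B (c *s x)) = c *s mkH 0 0 0 0 (A x) (B x)" ..
qed

lemma complex_linear_f_V: "complex_linear f_V"
  unfolding f_V_def
  by (intro complex_linear_mkH; unfold_locales)
     (simp_all add: vec_eq_iff algebra_simps add_divide_distrib diff_divide_distrib)

text \<open>The linear system \<open>z\<^sub>1 - z\<^sub>2 = \<surd>2 a\<close>, \<open>\<i> (z\<^sub>1 + z\<^sub>2) = \<surd>2 b\<close> is solved explicitly; this
  yields both injectivity and the range of \<open>f_V\<close>.\<close>

lemma f_V_eq_iff:
  "f_V z = mkH 0 0 0 0 (a *s axis 0 1 + b *s axis 1 1) 0 \<longleftrightarrow>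
     z $ 1 = (a - \<i> * b) / sqrt 2 \<and> z $ 2 = (- a - \<i> * b) / sqrt 2"
proof -
  have coeff: "c *s axis 0 1 + d *s axis 1 1 = a *s axis 0 1 + (b *s axis 1 1 :: octc) \<longleftrightarrow> c = a \<and> d = b" for c d
  proof
    assume *: "c *s axis 0 1 + d *s axis 1 1 = a *s axis 0 1 + (b *s axis 1 1 :: octc)"
    from arg_cong[OF *, of "\<lambda>Z. Z $ 0"] arg_cong[OF *, of "\<lambda>Z. Z $ 1"]
    show "c = a \<and> d = b" by (simp add: axis_def)
  qed simp
  have sqrt2: "complex_of_real (sqrt 2) * complex_of_real (sqrt 2) = 2"
    by (simp flip: of_real_mult)
  have "(x - y) / s = a \<and> \<i> * ((x + y) / s) = b \<longleftrightarrow> x = (a - \<i> * b) / s \<and> y = (- a - \<i> * b) / s"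
    if "s * s = 2" for x y s :: complex
  proof -
    have s: "s \<noteq> 0" using that by auto
    have "\<i> * c = b * s \<longleftrightarrow> c = - \<i> * b * s" for c
      by (auto simp: complex_eq_iff)
    then have "(x - y) / s = a \<and> \<i> * ((x + y) / s) = b \<longleftrightarrow> x - y = a * s \<and> x + y = - \<i> * b * s"
      using s by (simp add: divide_eq_eq)
    also have "\<dots> \<longleftrightarrow> 2 * x = (a - \<i> * b) * s \<and> 2 * y = (- a - \<i> * b) * s"
    proof -
      have "x - y = c \<and> x + y = d \<longleftrightarrow> 2 * x = c + d \<and> 2 * y = - c + d" for c d
        by (auto simp: complex_eq_iff)
      from this[of "a * s" "- \<i> * b * s"] show ?thesis by (simp add: ring_distribs)
    qed
    also have "\<dots> \<longleftrightarrow> x = (a - \<i> * b) / s \<and> y = (- a - \<i> * b) / s"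
    proof -
      have "2 * z = c * s \<longleftrightarrow> z = c / s" for z c
      proof -
        have "2 * z = c * s \<longleftrightarrow> s * (z * s) = s * c"
          by (simp add: that[symmetric] mult_ac)
        with s show ?thesis
          by (simp add: eq_divide_eq)
      qed
      then show ?thesis by simp
    qed
    finally show ?thesis .
  qed
  from this[OF sqrt2] show ?thesis
    unfolding f_V_def mkH_eq_iff by (simp add: coeff)
qed

lemma range_f_V:
  "range f_V = {mkH 0 0 0 0 (a *s axis 0 1 + b *s axis 1 1) 0 | a b. True}" (is "_ = ?R")
proof
  show "range f_V \<subseteq> ?R"
    unfolding f_V_def by blast
  show "?R \<subseteq> range f_V"
  proof
    fix w assume "w \<in> ?R"
    then obtain a b where "w = mkH 0 0 0 0 (a *s axis 0 1 + b *s axis 1 1) 0"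
      by blast
    then have "f_V (vector [(a - \<i> * b) / sqrt 2, (- a - \<i> * b) / sqrt 2]) = w"
      by (simp add: f_V_eq_iff)
    then show "w \<in> range f_V" by blast
  qed
qed

lemma inj_f_V: "inj f_V"
proof (rule injI)
  fix x y assume eq: "f_V x = f_V y"
  have "f_V y \<in> range f_V" by simp
  then obtain a b where "f_V y = mkH 0 0 0 0 (a *s axis 0 1 + b *s axis 1 1) 0"
    unfolding range_f_V by blast
  with eq have "x $ 1 = y $ 1 \<and> x $ 2 = y $ 2"
    by (simp add: f_V_eq_iff)
  then show "x = y"
    by (simp add: vec_eq_iff forall_2)
qed

text \<open>With \<open>a = (z\<^sub>1 - z\<^sub>2) / \<surd>2\<close> and \<open>b = \<i> (z\<^sub>1 + z\<^sub>2) / \<surd>2\<close>, the parallelogram law gives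
  \<open>|a|\<^sup>2 + |b|\<^sup>2 = |z\<^sub>1|\<^sup>2 + |z\<^sub>2|\<^sup>2\<close>, and the factor \<open>\<i>\<close> turns \<open>a\<^sup>2 + b\<^sup>2\<close> into a difference
  of squares, which is \<open>- 2 z\<^sub>1 z\<^sub>2\<close>.\<close>

lemma f_V_forms:
  defines "n \<equiv> \<lambda>(z :: complex ^ 2) j. (cmod (z $ j))\<^sup>2"
  shows "hform (f_V z) (f_V z) = n z 1 + n z 2"
    and "hform (sharp (f_V z)) (sharp (f_V z)) = n z 1 * n z 2"
proof -
  define s where "s = complex_of_real (sqrt 2)"
  have s: "s * s = 2" "cnj s = s"
    by (simp_all add: s_def flip: of_real_mult)
  define a b where "a = (z $ 1 - z $ 2) / s" and "b = \<i> * ((z $ 1 + z $ 2) / s)"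
  have f: "f_V z = mkH 0 0 0 0 (a *s axis 0 1 + b *s axis 1 1) 0"
    by (simp add: f_V_def a_def b_def s_def)
  have vcnj: "vcnj (a *s axis 0 1 + b *s axis 1 1 :: octc) = cnj a *s axis 0 1 + cnj b *s axis 1 1"
    by (simp add: vcnj_def vec_eq_iff axis_def)
  have n: "complex_of_real (n z j) = z $ j * cnj (z $ j)" for j
    unfolding n_def by (rule complex_norm_square)
  have "a * cnj a + b * cnj b = ((z $ 1 - z $ 2) * cnj (z $ 1 - z $ 2) + (z $ 1 + z $ 2) * cnj (z $ 1 + z $ 2)) / (s * s)"
    by (simp add: a_def b_def s(2) divide_inverse algebra_simps)
  also have "\<dots> = z $ 1 * cnj (z $ 1) + z $ 2 * cnj (z $ 2)"
    by (simp add: s(1) algebra_simps)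
  finally show "hform (f_V z) (f_V z) = n z 1 + n z 2"
    by (simp add: f hform_eq vcnj cbil_span_1_e1 n)
  have "a * a + b * b = ((z $ 1 - z $ 2) * (z $ 1 - z $ 2) - (z $ 1 + z $ 2) * (z $ 1 + z $ 2)) / (s * s)"
    by (simp add: a_def b_def divide_inverse algebra_simps)
  also have "\<dots> = - 2 * (z $ 1 * z $ 2)"
    by (simp add: s(1) algebra_simps)
  finally have "cbil (a *s axis 0 1 + b *s axis 1 1 :: octc) (a *s axis 0 1 + b *s axis 1 1) = - 2 * (z $ 1 * z $ 2)"
    by (simp add: cbil_span_1_e1)
  then show "hform (sharp (f_V z)) (sharp (f_V z)) = n z 1 * n z 2"
    by (simp add: f sharp_mkH_Hprime hform_eq n)
qed

lemma N_V_f_V: "Re (N_V (f_V z) (f_V z)) = (\<Prod>j\<in>UNIV. 1 - (cmod (z $ j))\<^sup>2)"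
  by (simp add: N_V_def f_V_forms UNIV_2 algebra_simps)

lemma f_V_in_Hprime: "f_V z \<in> Hprime"
  unfolding f_V_def Hprime_def by blast

text \<open>Positivity of \<open>(1 - x)(1 - y)\<close> leaves the cases \<open>x, y < 1\<close> and \<open>x, y > 1\<close>. The second
  one is excluded by the other two inequalities: they read
  \<open>(x - 1)(y - 1) > (x - 1) + (y - 1)\<close> and \<open>(x - 1) + (y - 1) < 1\<close>, and the product of two
  numbers in \<open>(0, 1)\<close> is less than their sum.\<close>

lemma f_V_in_Omega_V_iff: "f_V z \<in> Omega_V \<longleftrightarrow> z \<in> polydisk"
proof -
  define x y where "x = (cmod (z $ 1))\<^sup>2" and "y = (cmod (z $ 2))\<^sup>2"
  have nonneg: "x \<ge> 0" "y \<ge> 0" by (simp_all add: x_def y_def)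
  have "hform (sharp (f_V z)) (vcnj (f_V z)) = 0"
    unfolding f_V_def by (rule hform_sharp_vcnj_Hprime)
  then have "f_V z \<in> Omega_V \<longleftrightarrow>
      1 - (x + y) + x * y > 0 \<and> 3 - 2 * (x + y) + x * y > 0 \<and> 3 - (x + y) > 0"
    by (simp add: Omega_V_def Omega_VI_def f_V_in_Hprime f_V_forms x_def y_def)
  also have "\<dots> \<longleftrightarrow> x < 1 \<and> y < 1"
  proof
    assume *: "1 - (x + y) + x * y > 0 \<and> 3 - 2 * (x + y) + x * y > 0 \<and> 3 - (x + y) > 0"
    then have pos: "(1 - x) * (1 - y) > 0" by (simp add: algebra_simps)
    show "x < 1 \<and> y < 1"
    proof (rule ccontr)
      assume "\<not> (x < 1 \<and> y < 1)"
      with pos have "x > 1" "y > 1"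
        by (auto simp: zero_less_mult_iff)
      moreover from this * have "(x - 1) * (y - 1) \<le> (x - 1) * 1"
        by (intro mult_left_mono) auto
      ultimately show False
        using * by (simp add: algebra_simps)
    qed
  next
    assume "x < 1 \<and> y < 1"
    then have "(1 - x) * (1 - y) > 0" by simp
    with \<open>x < 1 \<and> y < 1\<close> show "1 - (x + y) + x * y > 0 \<and> 3 - 2 * (x + y) + x * y > 0 \<and> 3 - (x + y) > 0"
      by (simp add: algebra_simps)
  qed
  also have "\<dots> \<longleftrightarrow> z \<in> polydisk"
    by (simp add: polydisk_def forall_2 x_def y_def cmod_less_1_iff)
  finally show ?thesis .
qed

lemma image_f_V_polydisk: "f_V ` polydisk = Pi_prime"
proof -
  have span: "Z \<in> vec.span {axis 0 1, axis 1 1} \<longleftrightarrow> (\<exists>a b. Z = a *s axis 0 1 + b *s axis 1 1)" for Z :: octc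
    by (simp add: vec.span_insert diff_eq_eq add.commute)
  have Pi: "Pi_prime = Omega_V \<inter> range f_V"
    unfolding Pi_prime_def range_f_V span by blast
  show ?thesis
    unfolding Pi by (auto simp: f_V_in_Omega_V_iff)
qed

lemma holomorphic_embedding_f_V: "holomorphic_embedding polydisk Omega_V f_V"
proof -
  note lin = complex_linear_imp_linear[OF complex_linear_f_V]
  have dir: "dir_deriv f_V p = f_V" for p
    by (rule ext) (rule complex_linear_dir_deriv[OF complex_linear_f_V])
  have "holomorphic_map_on polydisk f_V"
    unfolding holomorphic_map_on_def
    using complex_linear_has_derivative[OF complex_linear_f_V] vec.linear_scale[OF complex_linear_f_V]
    by blast
  moreover obtain G where G: "linear G" "G \<circ> f_V = id"
    using linear_injective_left_inverse[OF lin inj_f_V] by blast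
  then have "homeomorphism polydisk (f_V ` polydisk) f_V G"
    by (auto simp: homeomorphism_def fun_eq_iff image_image intro!: linear_continuous_on
        linear_conv_bounded_linear[THEN iffD1] lin)
  ultimately show ?thesis
    unfolding holomorphic_embedding_def using f_V_in_Omega_V_iff inj_f_V by (auto simp: dir)
qed

lemma g_V_f_V: "g_V (f_V p) (f_V u) (f_V v) = g_polydisk p u v"
  unfolding g_V_def g_polydisk_def N_V_f_V[symmetric]
  by (rule kaehler_metric_compose_linear[OF complex_linear_f_V, symmetric])

lemma isometric_f_V: "isometric_on polydisk g_polydisk g_V f_V"
  by (simp add: isometric_on_def complex_linear_dir_deriv[OF complex_linear_f_V] g_V_f_V)

section \<open>Total geodesy\<close>

definition flip_normal :: "octc \<Rightarrow> octc" where
  "flip_normal Z = (\<chi> k. if k = 0 \<or> k = 1 then Z $ k else - Z $ k)"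

text \<open>The open set on which \<open>ln\<close> of the potential is a smooth function.\<close>

definition N_V_positive :: "herm3 set" where
  "N_V_positive = {q. Re (N_V q q) > 0}"

lemma open_N_V_positive: "open N_V_positive"
proof -
  have "differentiable_upto (Suc 0) UNIV (\<lambda>q. Re (N_V q q))"
    by (rule differentiable_upto_N_V)
  then have "continuous_on UNIV (\<lambda>q. Re (N_V q q))"
    by (auto simp: continuous_on_eq_continuous_at intro: has_derivative_continuous)
  then show ?thesis
    unfolding N_V_positive_def by (intro open_Collect_less continuous_on_const)
qed

lemma f_V_in_N_V_positive: "p \<in> polydisk \<Longrightarrow> f_V p \<in> N_V_positive"
  unfolding N_V_positive_def mem_Collect_eq N_V_f_V polydisk_def cmod_less_1_iff
  by (intro prod_pos) auto

lemma N_V_mirror_Z3: "N_V (mkH 0 0 0 0 A (- B)) (mkH 0 0 0 0 A (- B)) = N_V (mkH 0 0 0 0 A B) (mkH 0 0 0 0 A B)"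
  by (simp add: N_V_mkH oct_mult_minus_right vcnj_minus cbil_minus)

text \<open>On \<open>Z\<^sub>3 = 0\<close> the product \<open>Z\<^sub>2 Z\<^sub>3\<close> drops out of \<open>N_V\<close>, and the remaining terms are sums of
  squares over the components of \<open>Z\<^sub>2\<close>, unaffected by sign changes.\<close>

lemma N_V_mirror_Z2:
  "N_V (mkH 0 0 0 0 (flip_normal A) 0) (mkH 0 0 0 0 (flip_normal A) 0) = N_V (mkH 0 0 0 0 A 0) (mkH 0 0 0 0 A 0)"
proof -
  have "cbil (flip_normal A) (vcnj (flip_normal A)) = cbil A (vcnj A)"
       "cbil (flip_normal A) (flip_normal A) = cbil A A"
    unfolding cbil_def by (auto intro!: sum.cong simp: flip_normal_def vcnj_def)
  then show ?thesis by (simp add: N_V_mkH)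
qed

lemma complex_linear_oc: "complex_linear (\<lambda>z. oc z j)"
  by unfold_locales simp_all

text \<open>For directions with \<open>Z\<^sub>3 = 0\<close> the potential is first restricted to the subspace
  \<open>Z\<^sub>3 = 0\<close>, where \<open>flip_normal\<close> is a symmetry; for directions with \<open>Z\<^sub>2 = 0\<close> the sign change
  of \<open>Z\<^sub>3\<close> is used on all of \<open>Hprime\<close>.\<close>

lemma normal_to_f_V:
  assumes "p \<in> polydisk"
    and "\<xi> = mkH 0 0 0 0 Z 0 \<and> Z $ 0 = 0 \<and> Z $ 1 = 0 \<or> \<xi> = mkH 0 0 0 0 0 Z"
  shows "g_V (f_V p) (f_V u) \<xi> = 0" "christoffel g_V (f_V p) (f_V u) (f_V v) \<xi> = 0"
proof -
  let ?\<phi> = "\<lambda>q. Re (N_V q q)"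
  note normal = mirrored_direction_is_normal[OF open_N_V_positive differentiable_upto_N_V _
      f_V_in_N_V_positive[OF assms(1)], folded g_V_def]
  have pos: "?\<phi> q > 0" if "q \<in> N_V_positive" for q
    using that by (simp add: N_V_positive_def)
  have flip_f: "flip_normal (oc (f_V x) 2) = oc (f_V x) 2" for x
    by (simp add: f_V_def flip_normal_def vec_eq_iff axis_def)
  have f: "mkH 0 0 0 0 (oc (f_V x) 2) 0 = f_V x" "oc (f_V x) 3 = 0" for x
    by (simp_all add: f_V_def)
  have "g_V (f_V p) (f_V u) \<xi> = 0 \<and> christoffel g_V (f_V p) (f_V u) (f_V v) \<xi> = 0"
    using assms(2)
  proof (elim disjE conjE)
    assume \<xi>: "\<xi> = mkH 0 0 0 0 Z 0" "Z $ 0 = 0" "Z $ 1 = 0"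
    define L M where "L = (\<lambda>q. mkH 0 0 0 0 (oc q 2) 0)"
      and "M = (\<lambda>q. mkH 0 0 0 0 (flip_normal (oc q 2)) 0)"
    have L: "complex_linear L"
      unfolding L_def by (intro complex_linear_mkH complex_linear_oc vec.module_hom_zero)
    have M: "complex_linear M"
      unfolding M_def by (intro complex_linear_mkH vec.module_hom_zero; unfold_locales)
        (auto simp: flip_normal_def vec_eq_iff)
    have "flip_normal Z = - Z"
      using \<xi> by (auto simp: flip_normal_def vec_eq_iff)
    moreover have "- mkH 0 0 0 0 Z 0 = mkH 0 0 0 0 (- Z) 0"
      by (simp add: mkH_eq_iff)
    ultimately have \<xi>': "L \<xi> = \<xi>" "M \<xi> = - \<xi>"
      by (simp_all add: \<xi>(1) L_def M_def)
    have "?\<phi> (L q) = ?\<phi> (M q)" for q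
      by (simp add: L_def M_def N_V_mirror_Z2)
    moreover have "L (f_V x) = f_V x \<and> M (f_V x) = f_V x" for x
      by (simp add: L_def M_def f flip_f)
    ultimately show ?thesis
      using normal[OF pos L M _ _ \<xi>', of "f_V u" "f_V v"] by blast
  next
    assume \<xi>: "\<xi> = mkH 0 0 0 0 0 Z"
    define L M where "L = (\<lambda>q. mkH 0 0 0 0 (oc q 2) (oc q 3))"
      and "M = (\<lambda>q. mkH 0 0 0 0 (oc q 2) (- oc q 3))"
    have L: "complex_linear L"
      unfolding L_def by (intro complex_linear_mkH complex_linear_oc)
    have M: "complex_linear M"
      unfolding M_def by (intro complex_linear_mkH complex_linear_oc vec.module_hom_neg)
    have "- mkH 0 0 0 0 0 Z = mkH 0 0 0 0 0 (- Z)"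
      by (simp add: mkH_eq_iff)
    then have \<xi>': "L \<xi> = \<xi>" "M \<xi> = - \<xi>"
      by (simp_all add: \<xi> L_def M_def)
    have "?\<phi> (L q) = ?\<phi> (M q)" for q
      by (simp add: L_def M_def N_V_mirror_Z3)
    moreover have "L (f_V x) = f_V x \<and> M (f_V x) = f_V x" for x
      by (simp add: L_def M_def f)
    ultimately show ?thesis
      using normal[OF pos L M _ _ \<xi>', of "f_V u" "f_V v"] by blast
  qed
  then show "g_V (f_V p) (f_V u) \<xi> = 0" "christoffel g_V (f_V p) (f_V u) (f_V v) \<xi> = 0"
    by simp_all
qed

lemma g_polydisk_nondegenerate:
  fixes x :: "complex ^ 'k"
  assumes "p \<in> polydisk" "\<And>w. g_polydisk p w x = 0"
  shows "x = 0"
proof -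
  have "(\<Sum>j\<in>UNIV. (cmod (x $ j))\<^sup>2 / (1 - (cmod (p $ j))\<^sup>2)\<^sup>2) = 0"
    using assms(2)[of x] unfolding g_polydisk_eq[OF assms(1)]
    by (simp add: complex_norm_square[symmetric] del: of_real_power)
  then have "(cmod (x $ j))\<^sup>2 / (1 - (cmod (p $ j))\<^sup>2)\<^sup>2 = 0" for j
    by (subst (asm) sum_nonneg_eq_0_iff) auto
  moreover have "(cmod (p $ j))\<^sup>2 < 1" for j
    using assms(1) by (simp add: polydisk_def cmod_less_1_iff)
  ultimately show ?thesis
    by (simp add: vec_eq_iff) (metis less_irrefl)
qed

text \<open>A normal vector \<open>\<xi>\<close> is split into its tangential part \<open>f_V x\<close>, the part \<open>\<nu>\<close> in
  \<open>e\<^sub>2, \<dots>, e\<^sub>7\<close> of \<open>Z\<^sub>2\<close>, and the part \<open>\<mu>\<close> in \<open>Z\<^sub>3\<close>. Normality forces \<open>x = 0\<close>, and the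
  symmetries dispose of \<open>\<nu>\<close> and \<open>\<mu>\<close>.\<close>

lemma totally_geodesic_f_V: "totally_geodesic_on polydisk Hprime g_V f_V"
  unfolding totally_geodesic_on_def
proof (intro ballI allI)
  fix p u v \<xi>
  assume p: "p \<in> polydisk" and \<xi>: "\<xi> \<in> normal_vectors Hprime g_V f_V p"
  have dir: "dir_deriv f_V q w = f_V w" for q w
    by (rule complex_linear_dir_deriv[OF complex_linear_f_V])
  have add: "g_V (f_V p) a (c + d) = g_V (f_V p) a c + g_V (f_V p) a d" for a c d
    unfolding g_V_def
    by (rule kaehler_metric_add_right[OF open_N_V_positive differentiable_upto_N_V _
          f_V_in_N_V_positive[OF p]]) (simp add: N_V_positive_def)
  have christoffel_add: "christoffel g_V (f_V p) a b (c + d)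
      = christoffel g_V (f_V p) a b c + christoffel g_V (f_V p) a b d" for a b c d
    unfolding g_V_def
    by (rule christoffel_add_right[OF open_N_V_positive differentiable_upto_N_V _
          f_V_in_N_V_positive[OF p]]) (simp add: N_V_positive_def)
  obtain Z W where \<xi>_eq: "\<xi> = mkH 0 0 0 0 Z W"
    using \<xi> by (auto simp: normal_vectors_def Hprime_def)
  define T where "T = Z $ 0 *s axis 0 1 + (Z $ 1 *s axis 1 1 :: octc)"
  have "mkH 0 0 0 0 T 0 \<in> range f_V"
    unfolding range_f_V T_def by blast
  then obtain x where x: "f_V x = mkH 0 0 0 0 T 0"
    by (metis imageE)
  define \<nu> where "\<nu> = mkH 0 0 0 0 (Z - T) 0"
  define \<mu> where "\<mu> = mkH 0 0 0 0 0 W"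
  have split: "\<xi> = f_V x + (\<nu> + \<mu>)"
    unfolding \<xi>_eq x \<nu>_def \<mu>_def by (rule sym) (simp add: mkH_eq_iff)
  have "(Z - T) $ 0 = 0" "(Z - T) $ 1 = 0"
    by (simp_all add: T_def axis_def)
  then have \<nu>: "g_V (f_V p) (f_V u) \<nu> = 0" "christoffel g_V (f_V p) (f_V u) (f_V v) \<nu> = 0" for u v
    using normal_to_f_V[OF p, of \<nu> "Z - T"] by (simp_all add: \<nu>_def)
  have \<mu>: "g_V (f_V p) (f_V u) \<mu> = 0" "christoffel g_V (f_V p) (f_V u) (f_V v) \<mu> = 0" for u v
    using normal_to_f_V[OF p, of \<mu> W] by (simp_all add: \<mu>_def)
  have "g_polydisk p w x = 0" for w
  proof -
    have "g_V (f_V p) (f_V w) \<xi> = 0"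
      using \<xi> by (simp add: normal_vectors_def dir)
    then show ?thesis
      by (simp add: split add \<nu> \<mu> g_V_f_V)
  qed
  then have "x = 0"
    by (rule g_polydisk_nondegenerate[OF p])
  then have "f_V x = 0"
    using vec.linear_0[OF complex_linear_f_V] by simp
  then have "christoffel g_V (f_V p) (f_V u) (f_V v) \<xi> = 0"
    by (simp add: split christoffel_add \<nu> \<mu>)
  moreover have "dir_deriv (\<lambda>q. dir_deriv f_V q v) p u = 0"
    unfolding dir by (simp add: dir_deriv_def)
  moreover have "g_V q 0 w = 0" for q w
    by (simp add: g_V_def kaehler_metric_def kaehler_form_def del_delbar_def del_def delbar_def)
       (simp add: dir_deriv_def)
  ultimately show "second_fundamental_form g_V f_V p u v \<xi> = 0"
    by (simp add: second_fundamental_form_def dir)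
qed

theorem proposition2p2:
  shows "holomorphic_embedding polydisk Omega_V f_V \<and>
    isometric_on polydisk g_polydisk g_V f_V \<and>
    f_V ` polydisk = Pi_prime \<and>
    totally_geodesic_polydisk TYPE(2) Hprime Omega_V g_V Pi_prime \<and>
    CARD(2) = generic_norm_rank Hprime N_V \<and>
    generic_norm_rank Hprime N_V = 2"
  unfolding totally_geodesic_polydisk_def
  using holomorphic_embedding_f_V isometric_f_V image_f_V_polydisk totally_geodesic_f_V
    generic_norm_rank_V by auto

end
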